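(* Let $n \geq 2$ be an integer and let $K_n$ be the complete graph with $n$ vertices. Then $\gamma_{plsR}(K_n) = n-1$.
   Context: All graphs are finite, without loops or parallel edges. For a graph $G=(V,E)$ and $v\in V$, $N[v]=\{v\}\cup\{u : uv\in E\}$ is the closed neighborhood. A perfect locating signed Roman dominating (PLSRD) function on $G=(V,E)$ is a function $f: V\to\{-1,1,2\}$ such that: (C1) each vertex $v$ with $f(v)=-1$ is adjacent to exactly one vertex $u$ with $f(u)=2$; (C2) distinct vertices $v,w$ with $f(v)=f(w)=-1$ have no common neighbor $u$ with $f(u)=2$; (C3) for every vertex $v$, $\sum_{u\in N[v]} f(u)\geq 1$. The weight of $f$ is $f(V)=\sum_{v\in V} f(v)$. The perfect locating signed Roman domination number $\gamma_{plsR}(G)$ is the minimum weight over all PLSRD functions on $G$. *)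

theory Defs
  imports "Graph_Theory.Kuratowski"
begin

text \<open>
  A finite simple graph is a digraph \<open>G\<close> satisfying the locale predicate \<^const>\<open>graph\<close> (finite,
  loop-free, no parallel arcs, symmetric). Adjacency of \<open>u\<close> and \<open>v\<close> is
  \<open>u \<rightarrow>\<^bsub>G\<^esub> v\<close>, and the complete graph on \<open>n\<close> vertices is \<^const>\<open>complete_digraph\<close>.
\<close>

definition closed_nbhd :: "('a, 'b) pre_digraph \<Rightarrow> 'a \<Rightarrow> 'a set" where
  "closed_nbhd G v = {v} \<union> {u. u \<rightarrow>\<^bsub>G\<^esub> v}"

text \<open>
  A function on the vertex set is a total function on the vertex type; its values outside
  \<open>verts G\<close> are unconstrained and irrelevant.
\<close>

definition plsrd_function :: "('a, 'b) pre_digraph \<Rightarrow> ('a \<Rightarrow> int) \<Rightarrow> bool" where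
  "plsrd_function G f \<longleftrightarrow>
     f ` verts G \<subseteq> {-1, 1, 2} \<and>
     (\<forall>v\<in>verts G. f v = -1 \<longrightarrow> (\<exists>!u. v \<rightarrow>\<^bsub>G\<^esub> u \<and> f u = 2)) \<and>
     (\<forall>v\<in>verts G. \<forall>w\<in>verts G. v \<noteq> w \<and> f v = -1 \<and> f w = -1 \<longrightarrow>
        \<not> (\<exists>u. v \<rightarrow>\<^bsub>G\<^esub> u \<and> w \<rightarrow>\<^bsub>G\<^esub> u \<and> f u = 2)) \<and>
     (\<forall>v\<in>verts G. (\<Sum>u\<in>closed_nbhd G v. f u) \<ge> 1)"

definition weight :: "('a, 'b) pre_digraph \<Rightarrow> ('a \<Rightarrow> int) \<Rightarrow> int" where
  "weight G f = (\<Sum>v\<in>verts G. f v)"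

definition plsrd_number :: "('a, 'b) pre_digraph \<Rightarrow> int" where
  "plsrd_number G = Min {weight G f |f. plsrd_function G f}"

text \<open>For every graph, \<^const>\<open>Min\<close> is taken over a finite nonempty set, so it is the minimum.\<close>

lemma finite_plsrd_weights:
  assumes "graph G"
  shows "finite {weight G f |f. plsrd_function G f}"
proof -
  interpret graph G by fact
  have "{weight G f |f. plsrd_function G f}
          \<subseteq> {- int (card (verts G))..2 * int (card (verts G))}"
  proof clarify
    fix f assume "plsrd_function G f"
    then have "f ` verts G \<subseteq> {-1, 1, 2}" by (simp add: plsrd_function_def)
    then have "f v = -1 \<or> f v = 1 \<or> f v = 2" if "v \<in> verts G" for v
      using that by blast
    then have f: "- 1 \<le> f v" "f v \<le> 2" if "v \<in> verts G" for v
      using that by fastforce+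
    have "(\<Sum>v\<in>verts G. - 1) \<le> weight G f" "weight G f \<le> (\<Sum>v\<in>verts G. 2)"
      unfolding weight_def using f by (simp_all only: sum_mono)
    then show "weight G f \<in> {- int (card (verts G))..2 * int (card (verts G))}" by simp
  qed
  then show ?thesis by (rule finite_subset) simp
qed

lemma plsrd_weights_nonempty:
  assumes "graph G"
  shows "{weight G f |f. plsrd_function G f} \<noteq> {}"
proof -
  interpret graph G by fact
  have "finite (closed_nbhd G v)" if "v \<in> verts G" for v
    by (rule finite_subset[of _ "verts G"]) (use that in \<open>auto simp: closed_nbhd_def\<close>)
  moreover have "v \<in> closed_nbhd G v" for v by (simp add: closed_nbhd_def)
  ultimately have card: "0 < card (closed_nbhd G v)" if "v \<in> verts G" for v
    using that by (auto simp: card_gt_0_iff)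
  have "1 \<le> (\<Sum>u\<in>closed_nbhd G v. 1 :: int)" if "v \<in> verts G" for v
    using card[OF that] by simp
  then have "plsrd_function G (\<lambda>_. 1)" unfolding plsrd_function_def by (simp add: image_subset_iff)
  then show ?thesis by blast
qed

end

theory Submission
  imports Defs
begin

text \<open>In a complete graph any two vertices labelled \<open>-1\<close> share all vertices labelled \<open>2\<close>, so there is
  at most one \<open>-1\<close>, and it comes with a \<open>2\<close> that makes up for all but one of the lost weight.\<close>

lemma adj_complete_digraph:
  assumes "complete_digraph n G"
  shows "u \<rightarrow>\<^bsub>G\<^esub> v \<longleftrightarrow> u \<in> verts G \<and> v \<in> verts G \<and> u \<noteq> v"
  using assms by (auto simp: complete_digraph_def)

text \<open>This collapses (C3) at all vertices into the single condition that the weight is at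
  least 1.\<close>

lemma closed_nbhd_complete_digraph:
  assumes "complete_digraph n G" "v \<in> verts G"
  shows "closed_nbhd G v = verts G"
  using assms(2) by (auto simp: closed_nbhd_def adj_complete_digraph[OF assms(1)])

text \<open>Both bounds split off the vertex labelled \<open>-1\<close> and its partner labelled
  \<open>2\<close>, then treat the remaining vertices uniformly.\<close>

lemma weight_remove2:
  assumes "finite (verts G)" "u \<in> verts G" "v \<in> verts G" "u \<noteq> v"
  shows "weight G f = f u + (f v + (\<Sum>w\<in>verts G - {u} - {v}. f w))"
  using assms sum.remove[of "verts G" u f] sum.remove[of "verts G - {u}" v f]
  by (simp add: weight_def)

lemma weight_complete_digraph_ge:
  assumes K: "complete_digraph n G" and f: "plsrd_function G f"
  shows "int n - 1 \<le> weight G f"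
proof -
  interpret graph G using K by (simp add: complete_digraph_def)
  have card: "card (verts G) = n" using K by (simp add: complete_digraph_def)
  have vals: "f v \<in> {-1, 1, 2}" if "v \<in> verts G" for v
    using f that by (auto simp: plsrd_function_def)
  show ?thesis
  proof (cases "\<exists>v\<in>verts G. f v = -1")
    case False
    \<comment> \<open>Without a label \<open>-1\<close>, the weight is even at least
      \<open>n\<close>.\<close>
    then have "1 \<le> f v" if "v \<in> verts G" for v using vals[OF that] that by auto
    then have "(\<Sum>v\<in>verts G. 1) \<le> weight G f" unfolding weight_def by (rule sum_mono)
    then show ?thesis using card by simp
  next
    case True
    then obtain v where v: "v \<in> verts G" "f v = -1" by blast
    then obtain u where u: "u \<in> verts G" "u \<noteq> v" "f u = 2"
      using f unfolding plsrd_function_def adj_complete_digraph[OF K] by metis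
    \<comment> \<open>Otherwise \<open>u\<close> would be a common neighbor of \<open>v\<close> and
      \<open>w\<close> labelled \<open>2\<close>, against (C2).\<close>
    have "f w \<noteq> -1" if "w \<in> verts G" "w \<noteq> v" "w \<noteq> u" for w
      using f that v u unfolding plsrd_function_def adj_complete_digraph[OF K] by metis
    then have "1 \<le> f w" if "w \<in> verts G - {v} - {u}" for w
      using vals[of w] that by auto
    then have "(\<Sum>w\<in>verts G - {v} - {u}. 1) \<le> (\<Sum>w\<in>verts G - {v} - {u}. f w)"
      by (rule sum_mono)
    moreover have "weight G f = f v + (f u + (\<Sum>w\<in>verts G - {v} - {u}. f w))"
      using u v weight_remove2[of G v u f] by simp
    \<comment> \<open>As an inequality this survives truncated subtraction on naturals. The total is
      then at least -1 + 2 + (n - 2).\<close>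
    moreover have "int n - 2 \<le> int (card (verts G - {v} - {u}))"
      using u v card by (simp add: card_Diff_singleton_if)
    ultimately show ?thesis using u v by simp
  qed
qed

lemma plsrd_function_complete_digraph_attaining:
  assumes n: "n \<ge> 2" and K: "complete_digraph n G"
  obtains f where "plsrd_function G f" "weight G f = int n - 1"
proof -
  interpret graph G using K by (simp add: complete_digraph_def)
  have card: "card (verts G) = n" using K by (simp add: complete_digraph_def)
  then have "\<not> card (verts G) \<le> Suc 0" using n by simp
  then obtain a b where ab: "a \<in> verts G" "b \<in> verts G" "a \<noteq> b"
    by (auto simp: card_le_Suc0_iff_eq)
  \<comment> \<open>The equality case of the lower bound: one \<open>-1\<close>, one
    \<open>2\<close>, and \<open>1\<close> everywhere else.\<close>
  define f :: "'a \<Rightarrow> int" where "f = (\<lambda>_. 1)(a := -1, b := 2)"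
  have f_ab: "f a = -1" "f b = 2" using ab by (simp_all add: f_def)
  have "weight G f = f a + (f b + (\<Sum>w\<in>verts G - {a} - {b}. f w))"
    using ab weight_remove2[of G a b f] by simp
  also have "(\<Sum>w\<in>verts G - {a} - {b}. f w) = (\<Sum>w\<in>verts G - {a} - {b}. 1)"
    by (rule sum.cong) (auto simp: f_def)
  also have "\<dots> = int n - 2"
    using ab card n by (simp add: card_Diff_singleton_if)
  finally have weight: "weight G f = int n - 1" using f_ab by simp
  \<comment> \<open>Rewriting with these equivalences reduces (C1) to \<open>b\<close> being the
    only choice for \<open>a\<close>, and makes (C2) vacuous.\<close>
  have f_neg: "f v = -1 \<longleftrightarrow> v = a" and f_two: "f v = 2 \<longleftrightarrow> v = b" for v
    using ab by (auto simp: f_def)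
  \<comment> \<open>Each such sum is the whole weight n - 1, which is at least 1 because n \<ge>
    2.\<close>
  have "(\<Sum>u\<in>closed_nbhd G v. f u) \<ge> 1" if "v \<in> verts G" for v
    using weight n by (simp add: closed_nbhd_complete_digraph[OF K that] weight_def)
  moreover have "f ` verts G \<subseteq> {-1, 1, 2}" by (auto simp: f_def)
  ultimately have "plsrd_function G f"
    unfolding plsrd_function_def f_neg f_two adj_complete_digraph[OF K] using ab by blast
  then show ?thesis using weight that by blast
qed

theorem proposition1:
  fixes n :: nat and G :: "('a, 'b) pre_digraph"
  assumes "n \<ge> 2"
    and "complete_digraph n G"
  shows "plsrd_number G = int n - 1"
proof -
  have "graph G" using assms(2) by (simp add: complete_digraph_def)
  obtain f where "plsrd_function G f" "weight G f = int n - 1"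
    using plsrd_function_complete_digraph_attaining[OF assms] .
  then have "int n - 1 \<in> {weight G f |f. plsrd_function G f}" by force
  then show ?thesis unfolding plsrd_number_def
    using finite_plsrd_weights[OF \<open>graph G\<close>] weight_complete_digraph_ge[OF assms(2)]
    by (intro Min_eqI) auto
qed

end
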